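(* We have $$g(n,K_3,P_5)=\frac{n}{4}-o(n).$$
   Context: $P_5$ denotes the path on $5$ vertices and $K_3$ the triangle. For fixed graphs $H$ and $F$, the Constructor–Blocker game is played on the edge set of $K_n$: Constructor and Blocker alternately claim previously unclaimed edges, Constructor moving first. Constructor may only claim an edge if after claiming it his graph (all edges he has claimed) contains no copy of $F$ as a subgraph; Blocker may claim any unclaimed edge. The game ends when Constructor cannot claim a further edge or all edges are claimed. The score is the number of copies of $H$ (as subgraphs) all of whose edges were claimed by Constructor. Constructor maximizes, Blocker minimizes the score; $g(n,H,F)$ is the score under optimal play by both players. *)

theory Defs
  imports Complex_Main "HOL-Library.Landau_Symbols"
begin

text \<open>Undirected graphs are pairs of a vertex set and a set of two-element sets of vertices.\<close>

type_synonym 'a graph = "'a set \<times> 'a set set"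

definition simple_graph :: "'a graph \<Rightarrow> bool" where
  "simple_graph G \<longleftrightarrow> (\<forall>e\<in>snd G. e \<subseteq> fst G \<and> card e = 2)"

definition subgraph :: "'a graph \<Rightarrow> 'a graph \<Rightarrow> bool" where
  "subgraph S G \<longleftrightarrow> simple_graph S \<and> fst S \<subseteq> fst G \<and> snd S \<subseteq> snd G"

definition graph_iso :: "'a graph \<Rightarrow> 'b graph \<Rightarrow> bool" where
  "graph_iso G H \<longleftrightarrow> (\<exists>f. bij_betw f (fst G) (fst H) \<and> (\<lambda>e. f ` e) ` snd G = snd H)"

text \<open>Copies are subgraphs, not embeddings: automorphic embeddings give the same copy.\<close>

definition copies :: "'b graph \<Rightarrow> 'a graph \<Rightarrow> 'a graph set" where
  "copies H G = {S. subgraph S G \<and> graph_iso S H}"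

definition complete_graph :: "nat \<Rightarrow> nat graph" where
  "complete_graph n = ({..<n}, {e. e \<subseteq> {..<n} \<and> card e = 2})"

text \<open>The parameter counts vertices, not edges.\<close>

definition path_graph :: "nat \<Rightarrow> nat graph" where
  "path_graph n = ({..<n}, {{i, Suc i} | i. Suc i < n})"

text \<open>A position of the game on \<open>complete_graph n\<close> is given by the edge sets \<open>C\<close> and \<open>B\<close>
  claimed so far by Constructor and Blocker, and the player to move.\<close>

datatype player = Constructor | Blocker

definition unclaimed :: "nat \<Rightarrow> nat set set \<Rightarrow> nat set set \<Rightarrow> nat set set" where
  "unclaimed n C B = snd (complete_graph n) - (C \<union> B)"

definition constructor_moves ::
  "nat \<Rightarrow> 'f graph \<Rightarrow> nat set set \<Rightarrow> nat set set \<Rightarrow> nat set set" where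
  "constructor_moves n F C B =
     {e \<in> unclaimed n C B. copies F (fst (complete_graph n), insert e C) = {}}"

definition game_over :: "nat \<Rightarrow> 'f graph \<Rightarrow> nat set set \<Rightarrow> nat set set \<Rightarrow> bool" where
  "game_over n F C B \<longleftrightarrow> constructor_moves n F C B = {} \<or> unclaimed n C B = {}"

definition score :: "nat \<Rightarrow> 'h graph \<Rightarrow> nat set set \<Rightarrow> nat" where
  "score n H C = card (copies H (fst (complete_graph n), C))"

lemma finite_unclaimed: "finite (unclaimed n C B)"
  by (simp add: unclaimed_def complete_graph_def)

lemma card_unclaimed_less:
  assumes "e \<in> unclaimed n C B"
  shows "card (unclaimed n (insert e C) B) < card (unclaimed n C B)"
    and "card (unclaimed n C (insert e B)) < card (unclaimed n C B)"
proof -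
  have "unclaimed n (insert e C) B \<subset> unclaimed n C B"
    and "unclaimed n C (insert e B) \<subset> unclaimed n C B"
    using assms by (force simp: unclaimed_def)+
  then show "card (unclaimed n (insert e C) B) < card (unclaimed n C B)"
    and "card (unclaimed n C (insert e B)) < card (unclaimed n C B)"
    by (simp_all add: finite_unclaimed psubset_card_mono)
qed

text \<open>The final score when both players play optimally from the given position
  (backward induction).\<close>

context
  notes image_cong [fundef_cong]
begin

function game_value ::
  "nat \<Rightarrow> 'h graph \<Rightarrow> 'f graph \<Rightarrow> player \<Rightarrow> nat set set \<Rightarrow> nat set set \<Rightarrow> nat" where
  "game_value n H F Constructor C B =
     (if game_over n F C B then score n H C
      else MAX e\<in>constructor_moves n F C B. game_value n H F Blocker (insert e C) B)"
| "game_value n H F Blocker C B =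
     (if game_over n F C B then score n H C
      else MIN e\<in>unclaimed n C B. game_value n H F Constructor C (insert e B))"
  by pat_completeness auto

end

termination
  by (relation "measure (\<lambda>(n, H, F, p, C, B). card (unclaimed n C B))")
    (auto simp: constructor_moves_def intro: card_unclaimed_less)

declare game_value.simps [simp del]

definition constructor_blocker :: "nat \<Rightarrow> 'h graph \<Rightarrow> 'f graph \<Rightarrow> nat" where
  "constructor_blocker n H F = game_value n H F Constructor {} {}"

end

theory Submission
  imports Defs "HOL-Real_Asymp.Real_Asymp"
begin

text \<open>For the upper bound, in a graph without five-vertex paths in which no component is a triangle and no two
  triangles share an edge, the triangles together with one outside neighbour each are disjoint
  four-sets. Blocker enforces both conditions by keeping, for every union of components \<open>W\<close> on
  three or four vertices, the number of Constructor's edges in \<open>W\<close> at most the number of his own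
  plus \<open>|W| - 2\<close>: a move of Constructor violates this for at most one \<open>W\<close>, and by parity \<open>W\<close> then
  still contains an unclaimed edge.

  For the lower bound, Constructor repeatedly picks six vertices that he has not touched and that
  span no edge of Blocker. Such vertices exist as long as about \<open>7 sqrt n\<close> untouched vertices are
  left, since Blocker has claimed at most \<open>n\<close> edges. There he builds a star until two leaves can
  be joined, which yields a triangle on at most four vertices.\<close>

section \<open>Values of game positions\<close>

definition pairs :: "'a set \<Rightarrow> 'a set set" where
  "pairs W = {e. e \<subseteq> W \<and> card e = 2}"

lemma complete_graph_pairs: "complete_graph n = ({..<n}, pairs {..<n})"
  by (simp add: complete_graph_def pairs_def)

lemma finite_pairs: "finite W \<Longrightarrow> finite (pairs W)"
  by (simp add: pairs_def)

lemma pairs_mono: "W \<subseteq> X \<Longrightarrow> pairs W \<subseteq> pairs X"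
  by (auto simp: pairs_def)

lemma doubleton_in_pairs [simp]: "{x, y} \<in> pairs W \<longleftrightarrow> x \<in> W \<and> y \<in> W \<and> x \<noteq> y"
  by (auto simp: pairs_def card_insert_if)

lemma pairsE:
  assumes "e \<in> pairs W"
  obtains x y where "e = {x, y}" "x \<in> W" "y \<in> W" "x \<noteq> y"
  using assms by (auto simp: pairs_def card_2_iff)

lemma card_pairs: "finite W \<Longrightarrow> card (pairs W) = card W choose 2"
  unfolding pairs_def by (rule n_subsets)

lemma unclaimed_pairs: "unclaimed n C B = pairs {..<n} - (C \<union> B)"
  by (simp add: unclaimed_def complete_graph_pairs)

lemma finite_constructor_moves: "finite (constructor_moves n F C B)"
  using finite_unclaimed[of n C B] by (simp add: constructor_moves_def)

lemma finite_copies: "finite V \<Longrightarrow> finite (copies H (V, C))"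
  by (rule finite_subset[of _ "Pow V \<times> Pow (Pow V)"])
    (auto simp: copies_def subgraph_def simple_graph_def, blast)

lemma score_mono: "C \<subseteq> D \<Longrightarrow> score n H C \<le> score n H D"
  unfolding score_def
  by (rule card_mono) (auto simp: complete_graph_pairs finite_copies, auto simp: copies_def subgraph_def)

lemma game_value_constructor_ge:
  assumes "e \<in> constructor_moves n F C B"
  shows "game_value n H F Blocker (insert e C) B \<le> game_value n H F Constructor C B"
proof -
  have "\<not> game_over n F C B"
    using assms by (auto simp: game_over_def constructor_moves_def)
  then have "game_value n H F Constructor C B =
      (MAX e\<in>constructor_moves n F C B. game_value n H F Blocker (insert e C) B)"
    by (subst game_value.simps) simp
  moreover have "game_value n H F Blocker (insert e C) B \<le> \<dots>"
    using assms finite_constructor_moves[of n F C B] by (intro Max_ge) auto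
  ultimately show ?thesis by simp
qed

lemma game_value_constructor_le:
  assumes "score n H C \<le> k"
    and "\<And>e. e \<in> constructor_moves n F C B \<Longrightarrow> game_value n H F Blocker (insert e C) B \<le> k"
  shows "game_value n H F Constructor C B \<le> k"
  using assms finite_constructor_moves[of n F C B]
  by (subst game_value.simps) (auto simp: game_over_def)

text \<open>The game can stop with unclaimed edges left because Constructor is stuck, so a bound on
  the current score accompanies the one good reply.\<close>

lemma game_value_blocker_le:
  assumes "score n H C \<le> k"
    and "unclaimed n C B \<noteq> {} \<Longrightarrow>
      \<exists>f\<in>unclaimed n C B. game_value n H F Constructor C (insert f B) \<le> k"
  shows "game_value n H F Blocker C B \<le> k"
proof (cases "game_over n F C B")
  case True
  then show ?thesis using assms(1) by (subst game_value.simps) simp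
next
  case False
  then obtain f where f: "f \<in> unclaimed n C B" "game_value n H F Constructor C (insert f B) \<le> k"
    using assms(2) by (auto simp: game_over_def)
  have "game_value n H F Blocker C B =
      (MIN e\<in>unclaimed n C B. game_value n H F Constructor C (insert e B))"
    using False by (subst game_value.simps) simp
  also have "\<dots> \<le> game_value n H F Constructor C (insert f B)"
    using f finite_unclaimed[of n C B] by (intro Min_le) auto
  finally show ?thesis using f(2) by simp
qed

text \<open>Blocker may also pass: this covers the positions where the game is over.\<close>

lemma game_value_blocker_ge:
  assumes "\<And>f B'. finite f \<Longrightarrow> card f \<le> 2 \<Longrightarrow> B \<subseteq> B' \<Longrightarrow> B' \<subseteq> insert f B \<Longrightarrow>
      k \<le> game_value n H F Constructor C B'"
  shows "k \<le> game_value n H F Blocker C B"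
proof (cases "game_over n F C B")
  case True
  have "k \<le> game_value n H F Constructor C B"
    by (rule assms[of "{}"]) auto
  then show ?thesis using True by (simp add: game_value.simps)
next
  case False
  have "k \<le> game_value n H F Constructor C (insert f B)" if "f \<in> unclaimed n C B" for f
  proof (rule assms[of f])
    have "card f = 2" using that by (simp add: unclaimed_pairs pairs_def)
    then show "card f \<le> 2" "finite f" by (auto intro: card_ge_0_finite)
  qed auto
  then show ?thesis
    using False finite_unclaimed[of n C B]
    by (subst game_value.simps) (auto simp: game_over_def)
qed

text \<open>Constructor never loses an edge, so the score cannot drop as play continues; the
  induction follows the game tree.\<close>

lemma score_le_game_value: "score n H C \<le> game_value n H F p C B"
proof (induction n H F p C B rule: game_value.induct)
  case (1 n H F C B)
  show ?case
  proof (cases "game_over n F C B")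
    case True
    then show ?thesis by (simp add: game_value.simps)
  next
    case False
    then obtain e where e: "e \<in> constructor_moves n F C B"
      by (auto simp: game_over_def)
    have "score n H C \<le> score n H (insert e C)"
      by (rule score_mono) auto
    also have "\<dots> \<le> game_value n H F Blocker (insert e C) B"
      using 1 False e by blast
    also have "\<dots> \<le> game_value n H F Constructor C B"
      using e by (rule game_value_constructor_ge)
    finally show ?thesis .
  qed
next
  case (2 n H F C B)
  then show ?case
    using finite_unclaimed[of n C B]
    by (subst game_value.simps) (auto simp: game_over_def)
qed

section \<open>Triangles and paths on five vertices\<close>

definition triangles :: "nat \<Rightarrow> nat set set \<Rightarrow> nat set set" where
  "triangles n C = {T. T \<subseteq> {..<n} \<and> card T = 3 \<and> pairs T \<subseteq> C}"

definition has_path5 :: "'a set set \<Rightarrow> bool" where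
  "has_path5 C \<longleftrightarrow> (\<exists>a b c d e. distinct [a, b, c, d, e] \<and>
     {a, b} \<in> C \<and> {b, c} \<in> C \<and> {c, d} \<in> C \<and> {d, e} \<in> C)"

lemma image_pairs_bij_betw:
  assumes "bij_betw f A B"
  shows "(`) f ` pairs A = pairs B"
proof (intro equalityI subsetI)
  fix e assume "e \<in> (`) f ` pairs A"
  then show "e \<in> pairs B"
    using assms by (auto simp: bij_betw_def pairs_def card_image inj_on_subset)
next
  fix e assume e: "e \<in> pairs B"
  then obtain D where D: "D \<subseteq> A" "e = f ` D"
    using assms by (auto simp: pairs_def bij_betw_def subset_image_iff)
  then have "card D = 2"
    using e assms by (metis (mono_tags) bij_betw_def card_image inj_on_subset mem_Collect_eq pairs_def)
  then show "e \<in> (`) f ` pairs A" using D by (auto simp: pairs_def)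
qed

text \<open>An isomorphism with the complete graph forces every pair of the vertex set to be an
  edge, so a copy is determined by its three vertices. Scores thus become counts of three-element
  sets.\<close>

lemma copies_triangle:
  "copies (complete_graph 3) ({..<n}, C) = (\<lambda>T. (T, pairs T)) ` triangles n C"
proof (intro equalityI subsetI)
  fix S assume S: "S \<in> copies (complete_graph 3) ({..<n}, C)"
  obtain V E where VE: "S = (V, E)" by (cases S)
  from S obtain f :: "nat \<Rightarrow> nat" where f: "bij_betw f V {..<3}" "(`) f ` E = pairs {..<3}"
    and sub: "V \<subseteq> {..<n}" "E \<subseteq> C" "E \<subseteq> pairs V"
    by (auto simp: VE copies_def subgraph_def graph_iso_def complete_graph_pairs
        simple_graph_def pairs_def)
  \<comment> \<open>The image of a pair of \<open>V\<close> is an edge of the triangle, hence also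
    the image of a member of \<open>E\<close>; injectivity of \<open>f\<close> makes that member the
    pair itself.\<close>
  have "pairs V \<subseteq> E"
  proof
    fix e assume e: "e \<in> pairs V"
    then have "f ` e \<in> (`) f ` pairs V" by (rule imageI)
    then have "f ` e \<in> (`) f ` E"
      by (simp only: image_pairs_bij_betw[OF f(1)] f(2))
    then obtain e' where "e' \<in> E" "f ` e = f ` e'" by auto
    moreover have "e \<subseteq> V" "e' \<subseteq> V"
      using e sub \<open>e' \<in> E\<close> by (auto simp: pairs_def)
    ultimately show "e \<in> E"
      using f(1) by (metis bij_betw_def inj_on_image_eq_iff)
  qed
  moreover have "card V = 3" using bij_betw_same_card[OF f(1)] by simp
  ultimately show "S \<in> (\<lambda>T. (T, pairs T)) ` triangles n C"
    using sub by (auto simp: VE triangles_def)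
next
  fix S assume "S \<in> (\<lambda>T. (T, pairs T)) ` triangles n C"
  then obtain T where T: "S = (T, pairs T)" "T \<subseteq> {..<n}" "card T = 3" "pairs T \<subseteq> C"
    by (auto simp: triangles_def)
  then have "finite T" by (simp add: card_ge_0_finite)
  then obtain f where f: "bij_betw f T {..<3::nat}"
    using T(3) by (metis card_lessThan finite_lessThan finite_same_card_bij)
  show "S \<in> copies (complete_graph 3) ({..<n}, C)"
    using T f image_pairs_bij_betw[OF f]
    by (auto simp: copies_def subgraph_def graph_iso_def complete_graph_pairs
        simple_graph_def pairs_def)
qed

lemma score_triangle: "score n (complete_graph 3) C = card (triangles n C)"
  unfolding score_def
  by (simp add: complete_graph_pairs[of n] copies_triangle card_image inj_on_def)

lemma triangleE:
  assumes "T \<in> triangles n C" "u \<in> T"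
  obtains x y where "T = {u, x, y}" "distinct [u, x, y]" "{u, x} \<in> C" "{u, y} \<in> C" "{x, y} \<in> C"
proof -
  have T: "card T = 3" "pairs T \<subseteq> C" using assms by (auto simp: triangles_def)
  then have "card (T - {u}) = 2" using assms(2) by simp
  then obtain x y where xy: "T - {u} = {x, y}" "x \<noteq> y" by (auto simp: card_2_iff)
  then have "T = {u, x, y}" "distinct [u, x, y]" using assms(2) by auto
  moreover from this have "{u, x} \<in> pairs T" "{u, y} \<in> pairs T" "{x, y} \<in> pairs T" by auto
  ultimately show ?thesis using that T by blast
qed

text \<open>Serves to prolong a path through a triangle; both orientations of the first edge are
  given because a path may run into \<open>u\<close> or out of it.\<close>

lemma triangle_pathE:
  assumes "T \<in> triangles n C" "u \<in> T"
  obtains x y where "x \<in> T" "y \<in> T" "distinct [u, x, y]" "{u, x} \<in> C" "{x, u} \<in> C" "{x, y} \<in> C"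
proof -
  obtain x y where "T = {u, x, y}" "distinct [u, x, y]" "{u, x} \<in> C" "{u, y} \<in> C" "{x, y} \<in> C"
    using assms by (rule triangleE)
  moreover from this have "{x, u} \<in> C" by (simp add: insert_commute)
  ultimately show ?thesis using that[of x y] by simp
qed

section \<open>Five-vertex paths as vertex sequences\<close>

lemma path_graph_5: "path_graph 5 = ({..<5}, {{0, 1}, {1, 2}, {2, 3}, {3, 4}})"
proof -
  have "{{i, Suc i} | i. Suc i < 5} = (\<lambda>i. {i, Suc i}) ` {..<4}" by auto
  also have "{..<4::nat} = {0, 1, 2, 3}" by auto
  finally show ?thesis by (simp add: path_graph_def numeral_eq_Suc)
qed

lemma copies_path5_iff:
  fixes n :: nat
  assumes "C \<subseteq> pairs {..<n}"
  shows "copies (path_graph 5) ({..<n}, C) = {} \<longleftrightarrow> \<not> has_path5 C"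
proof -
  have "has_path5 C" if S: "S \<in> copies (path_graph 5) ({..<n}, C)" for S :: "nat graph"
  proof -
    from S obtain f where f: "bij_betw f (fst S) {..<5::nat}"
      and E: "(`) f ` snd S = {{0, 1}, {1, 2}, {2, 3}, {3, 4}}"
      and sub: "snd S \<subseteq> C" "\<And>e. e \<in> snd S \<Longrightarrow> e \<subseteq> fst S"
      by (auto simp: copies_def subgraph_def graph_iso_def path_graph_5 simple_graph_def)
    \<comment> \<open>The inverse isomorphism lists the vertices of the copy in the order of the
      path.\<close>
    define g where "g = inv_into (fst S) f"
    have g: "bij_betw g {..<5} (fst S)"
      unfolding g_def by (rule bij_betw_inv_into[OF f])
    have edge: "{g i, g j} \<in> C" if "{i, j} \<in> {{0, 1}, {1, 2}, {2, 3}, {3, 4}}" for i j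
    proof -
      from that obtain e where e: "e \<in> snd S" "{i, j} = f ` e" unfolding E[symmetric] by auto
      then have "g ` {i, j} = e"
        using f sub by (simp add: g_def bij_betw_def inv_into_image_cancel)
      then have "{g i, g j} = e" by simp
      then show ?thesis using e sub by auto
    qed
    have inj: "g i = g j \<longleftrightarrow> i = j" if "i < 5" "j < 5" for i j
      using g that by (auto simp: bij_betw_def inj_on_def)
    have "distinct [g 0, g 1, g 2, g 3, g 4]"
      by (simp add: inj)
    then show ?thesis
      unfolding has_path5_def
      by (intro exI[of _ "g 0"] exI[of _ "g 1"] exI[of _ "g 2"] exI[of _ "g 3"] exI[of _ "g 4"])
        (simp add: edge)
  qed
  moreover have "copies (path_graph 5) ({..<n}, C) \<noteq> {}" if P: "has_path5 C"
  proof -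
    from P obtain a b c d e where D: "distinct [a, b, c, d, e]"
      and E: "{a, b} \<in> C" "{b, c} \<in> C" "{c, d} \<in> C" "{d, e} \<in> C"
      unfolding has_path5_def by auto
    \<comment> \<open>Each vertex is sent to its position on the path; the default 4 is the position
      of \<open>e\<close>.\<close>
    define f :: "nat \<Rightarrow> nat" where
      "f = (\<lambda>x. if x = a then 0 else if x = b then 1 else if x = c then 2 else if x = d then 3 else 4)"
    have vals: "f a = 0" "f b = 1" "f c = 2" "f d = 3" "f e = 4"
      using D by (auto simp: f_def)
    have "{..<5::nat} = {0, 1, 2, 3, 4}" by auto
    then have "bij_betw f {a, b, c, d, e} {..<5}"
      by (auto simp: bij_betw_def inj_on_def vals)
    then have "graph_iso ({a, b, c, d, e}, {{a, b}, {b, c}, {c, d}, {d, e}}) (path_graph 5)"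
      unfolding graph_iso_def path_graph_5
      by (intro exI[of _ f] conjI) (simp_all only: fst_conv snd_conv image_insert image_empty vals)
    moreover have "subgraph ({a, b, c, d, e}, {{a, b}, {b, c}, {c, d}, {d, e}}) ({..<n}, C)"
      using D E subsetD[OF assms E(1)] subsetD[OF assms E(2)] subsetD[OF assms E(3)] subsetD[OF assms E(4)]
      unfolding subgraph_def simple_graph_def by simp
    ultimately show ?thesis unfolding copies_def by blast
  qed
  ultimately show ?thesis by blast
qed

lemma constructor_moves_path5:
  assumes "C \<subseteq> pairs {..<n}"
  shows "constructor_moves n (path_graph 5) C B =
    {e \<in> pairs {..<n} - (C \<union> B). \<not> has_path5 (insert e C)}"
proof -
  have "copies (path_graph 5) ({..<n}, insert e C) = {} \<longleftrightarrow> \<not> has_path5 (insert e C)"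
    if "e \<in> pairs {..<n}" for e
    by (rule copies_path5_iff) (use assms that in auto)
  then show ?thesis
    by (auto simp: constructor_moves_def unclaimed_pairs complete_graph_pairs)
qed

text \<open>These \<open>W\<close> are the unions of connected components of \<open>C\<close>, where
  untouched vertices count as singleton components.\<close>

definition closed_under :: "'a set set \<Rightarrow> 'a set \<Rightarrow> bool" where
  "closed_under C W \<longleftrightarrow> (\<forall>e\<in>C. e \<inter> W \<noteq> {} \<longrightarrow> e \<subseteq> W)"

lemma closed_underD: "closed_under C W \<Longrightarrow> e \<in> C \<Longrightarrow> x \<in> W \<Longrightarrow> x \<in> e \<Longrightarrow> e \<subseteq> W"
  by (auto simp: closed_under_def)

lemma closed_under_Int: "closed_under C W \<Longrightarrow> closed_under C X \<Longrightarrow> closed_under C (W \<inter> X)"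
  by (fastforce simp: closed_under_def)

lemma closed_under_subset: "closed_under D W \<Longrightarrow> C \<subseteq> D \<Longrightarrow> closed_under C W"
  by (auto simp: closed_under_def)

section \<open>Blocker's strategy\<close>

text \<open>After each of Blocker's moves the invariant holds with \<open>s = 2\<close>; a move of Constructor
  costs at most one, so it always holds with \<open>s = 1\<close>, which still excludes isolated triangles
  and two triangles with a common edge.\<close>

definition guarded :: "nat \<Rightarrow> nat set set \<Rightarrow> nat set set \<Rightarrow> nat \<Rightarrow> bool" where
  "guarded n C B s \<longleftrightarrow> (\<forall>W. W \<subseteq> {..<n} \<and> (card W = 3 \<or> card W = 4) \<and> closed_under C W \<longrightarrow>
     card (C \<inter> pairs W) + s \<le> card (B \<inter> pairs W) + card W)"

lemma guardedD:
  assumes "guarded n C B s" "W \<subseteq> {..<n}" "card W = 3 \<or> card W = 4" "closed_under C W"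
  shows "card (C \<inter> pairs W) + s \<le> card (B \<inter> pairs W) + card W"
  using assms by (simp add: guarded_def)

lemma card_disjoint_pairs:
  assumes "C \<inter> B = {}" "finite W"
  shows "card (C \<inter> pairs W) + card (B \<inter> pairs W) = card ((C \<union> B) \<inter> pairs W)"
  using assms finite_pairs[of W] by (subst card_Un_disjoint[symmetric]) (auto simp: Int_Un_distrib2)

lemma card_disjoint_pairs_le:
  assumes "C \<inter> B = {}" "finite W"
  shows "card (C \<inter> pairs W) + card (B \<inter> pairs W) \<le> card W choose 2"
  using assms card_mono[OF finite_pairs, of W "(C \<union> B) \<inter> pairs W"]
  by (simp add: card_disjoint_pairs card_pairs)

text \<open>One more edge raises the left-hand count by at most one, and a set closed under the
  larger graph was closed before.\<close>

lemma guarded_insert_constructor: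
  assumes "guarded n C B 2"
  shows "guarded n (insert e C) B 1"
  unfolding guarded_def
proof (intro allI impI)
  fix W assume W: "W \<subseteq> {..<n} \<and> (card W = 3 \<or> card W = 4) \<and> closed_under (insert e C) W"
  then have "closed_under C W" by (auto intro: closed_under_subset)
  with W have "card (C \<inter> pairs W) + 2 \<le> card (B \<inter> pairs W) + card W"
    using guardedD[OF assms] by blast
  moreover have "card (insert e C \<inter> pairs W) \<le> card (C \<inter> pairs W) + 1"
    using W finite_subset[of W "{..<n}"]
    by (auto simp: Int_insert_left card_insert_if finite_pairs)
  ultimately show "card (insert e C \<inter> pairs W) + 1 \<le> card (B \<inter> pairs W) + card W" by linarith
qed

text \<open>At most one set violates the bound with \<open>s = 2\<close> after Constructor's move.
  Blocker repairs it by claiming an edge inside it, and plays arbitrarily if there is no such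
  set.\<close>

lemma guarded_insert_blocker:
  assumes "guarded n C B 2" "C \<inter> B = {}" "e \<in> pairs {..<n} - (C \<union> B)"
    and ne: "unclaimed n (insert e C) B \<noteq> {}"
  shows "\<exists>f\<in>unclaimed n (insert e C) B. guarded n (insert e C) (insert f B) 2"
proof -
  define D where "D = insert e C"
  have disj: "D \<inter> B = {}" using assms by (auto simp: D_def)
  have weak: "guarded n D B 1"
    unfolding D_def by (rule guarded_insert_constructor) fact
  define bad where "bad W \<longleftrightarrow> W \<subseteq> {..<n} \<and> (card W = 3 \<or> card W = 4) \<and> closed_under D W \<and>
     card (B \<inter> pairs W) + card W < card (D \<inter> pairs W) + 2" for W
  \<comment> \<open>A set without both ends of \<open>e\<close> had the same count before the move,
    when the bound held.\<close>
  have bad_edge: "e \<subseteq> W" if "bad W" for W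
  proof (rule ccontr)
    assume "\<not> e \<subseteq> W"
    then have "D \<inter> pairs W = C \<inter> pairs W" by (auto simp: D_def pairs_def)
    moreover have "closed_under C W"
      using that by (auto simp: bad_def D_def intro: closed_under_subset)
    ultimately show False
      using guardedD[OF assms(1), of W] that by (auto simp: bad_def)
  qed
  \<comment> \<open>A proper closed part \<open>Y\<close> containing \<open>e\<close> leaves only
    one or two vertices of \<open>W\<close>, too few to reach the \<open>card W - 1\<close> edges
    that a violation needs.\<close>
  have bad_minimal: False if W: "bad W" and Y: "closed_under D Y" "Y \<subset> W" "e \<subseteq> Y" for W Y
  proof -
    have fin: "finite W" using W by (auto simp: bad_def intro: finite_subset)
    then have finY: "finite Y" using Y by (auto intro: finite_subset)
    have cardY: "card Y < card W" using Y fin by (simp add: psubset_card_mono)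
    have "card e = 2" using assms(3) by (simp add: pairs_def)
    then have Y2: "2 \<le> card Y" using Y finY card_mono by metis
    have WY: "card (W - Y) = card W - card Y"
      using Y finY by (simp add: card_Diff_subset)
    \<comment> \<open>Since \<open>Y\<close> is closed, no edge of \<open>D\<close> joins it to
      \<open>W - Y\<close>.\<close>
    have "D \<inter> pairs W \<subseteq> (D \<inter> pairs Y) \<union> (D \<inter> pairs (W - Y))"
      using Y(1) by (auto simp: pairs_def closed_under_def)
    then have "card (D \<inter> pairs W) \<le> card ((D \<inter> pairs Y) \<union> (D \<inter> pairs (W - Y)))"
      using finY fin by (intro card_mono) (simp_all add: finite_pairs)
    also have "\<dots> \<le> card (D \<inter> pairs Y) + card (D \<inter> pairs (W - Y))"
      by (rule card_Un_le)
    finally have split: "card (D \<inter> pairs W) \<le> card (D \<inter> pairs Y) + card (D \<inter> pairs (W - Y))" .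
    have le: "card (D \<inter> pairs X) + card (B \<inter> pairs X) \<le> card X choose 2" if "finite X" for X
      using disj that by (rule card_disjoint_pairs_le)
    have large: "card W \<le> card (D \<inter> pairs W) + 1"
      using W by (auto simp: bad_def)
    have "card W = 3 \<or> card W = 4"
      using W by (simp add: bad_def)
    then have "card Y = 2 \<or> card Y = 3 \<and> card W = 4"
      using cardY Y2 by linarith
    then consider "card Y = 2" | "card Y = 3" "card W = 4"
      by blast
    then show False
    proof cases
      case 1
      \<comment> \<open>The rest has one or two vertices and so \<open>card W - 3\<close> pairs;
        with the single pair in \<open>Y\<close> this allows at most \<open>card W - 2\<close>
        edges.\<close>
      have "card W - card Y choose 2 = card W - 3"
        using W 1 by (auto simp: bad_def numeral_eq_Suc)
      then show False
        using split le[of Y] le[of "W - Y"] finY fin 1 WY large cardY by simp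
    next
      case 2
      \<comment> \<open>Among the three pairs in \<open>Y\<close>, the weak bound leaves Constructor
        at most two, and the fourth vertex of \<open>W\<close> adds no edge; three would be
        needed.\<close>
      have "card (D \<inter> pairs Y) + 1 \<le> card (B \<inter> pairs Y) + card Y"
        using weak by (rule guardedD) (use W Y 2 in \<open>auto simp: bad_def\<close>)
      moreover have "(3::nat) choose 2 = 3" by (simp_all add: numeral_eq_Suc)
      ultimately show False
        using split le[of Y] le[of "W - Y"] finY fin 2 WY large by (simp add: binomial_eq_0)
    qed
  qed
  \<comment> \<open>The intersection of two violating sets is closed, contains \<open>e\<close>, and
    is a proper part of one of them.\<close>
  have bad_unique: "W = X" if "bad W" "bad X" for W X
  proof (rule ccontr)
    assume "W \<noteq> X"
    then have "W \<inter> X \<subset> W \<or> W \<inter> X \<subset> X" by auto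
    moreover have "closed_under D (W \<inter> X)" "e \<subseteq> W \<inter> X"
      using that bad_edge by (auto simp: bad_def intro: closed_under_Int)
    ultimately show False using bad_minimal that by blast
  qed
  have mono: "card (B \<inter> pairs W) \<le> card (insert f B \<inter> pairs W)" if "W \<subseteq> {..<n}" for f W
    using that by (intro card_mono) (auto intro!: finite_pairs intro: finite_subset)
  have "\<exists>f\<in>unclaimed n D B. guarded n D (insert f B) 2"
  proof (cases "\<exists>W. bad W")
    case False
    \<comment> \<open>Without a violating set any reply works, as Blocker's edges only enlarge the
      right-hand side.\<close>
    obtain f where "f \<in> unclaimed n D B" using ne by (auto simp: D_def)
    moreover have "guarded n D (insert f B) 2"
      unfolding guarded_def
    proof (intro allI impI)
      fix W assume W: "W \<subseteq> {..<n} \<and> (card W = 3 \<or> card W = 4) \<and> closed_under D W"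
      then have "card (D \<inter> pairs W) + 2 \<le> card (B \<inter> pairs W) + card W"
        using False by (auto simp: bad_def not_less)
      then show "card (D \<inter> pairs W) + 2 \<le> card (insert f B \<inter> pairs W) + card W"
        using mono[of W f] W by auto
    qed
    ultimately show ?thesis by blast
  next
    case True
    then obtain W where W: "bad W" by blast
    then have fin: "finite W" by (auto simp: bad_def intro: finite_subset)
    have tight: "card (D \<inter> pairs W) + 1 = card (B \<inter> pairs W) + card W"
      using W guardedD[OF weak, of W] by (auto simp: bad_def)
    \<comment> \<open>By \<open>tight\<close> the two counts differ by 2 or 3 according to
      \<open>card W\<close>, whereas in a fully claimed \<open>W\<close> their sum would be 3 or 6
      respectively: the parities clash.\<close>
    have "\<not> pairs W \<subseteq> D \<union> B"
    proof
      assume "pairs W \<subseteq> D \<union> B"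
      then have "(D \<union> B) \<inter> pairs W = pairs W" by auto
      then have "card (D \<inter> pairs W) + card (B \<inter> pairs W) = card W choose 2"
        using card_disjoint_pairs[OF disj fin] by (simp add: card_pairs fin)
      moreover have "(3::nat) choose 2 = 3" "(4::nat) choose 2 = 6" by (simp_all add: numeral_eq_Suc)
      ultimately show False using tight W unfolding bad_def by (elim conjE disjE) (simp, presburger)+
    qed
    then obtain f where f: "f \<in> pairs W" "f \<notin> D" "f \<notin> B" by auto
    then have "f \<in> unclaimed n D B"
      using W by (auto simp: unclaimed_pairs bad_def dest: pairs_mono)
    moreover have "guarded n D (insert f B) 2"
      unfolding guarded_def
    proof (intro allI impI)
      fix X assume X: "X \<subseteq> {..<n} \<and> (card X = 3 \<or> card X = 4) \<and> closed_under D X"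
      show "card (D \<inter> pairs X) + 2 \<le> card (insert f B \<inter> pairs X) + card X"
      proof (cases "bad X")
        case True
        then have "X = W" using W bad_unique by blast
        then show ?thesis using tight f fin by (simp add: Int_insert_left finite_pairs)
      next
        case False
        then have "card (D \<inter> pairs X) + 2 \<le> card (B \<inter> pairs X) + card X"
          using X by (auto simp: bad_def not_less)
        then show ?thesis using mono[of X f] X by auto
      qed
    qed
    ultimately show ?thesis by blast
  qed
  then show ?thesis by (simp add: D_def)
qed

section \<open>Triangles in guarded graphs without five-vertex paths\<close>

lemma has_path5I:
  assumes "{a, b} \<in> C" "{b, c} \<in> C" "{c, d} \<in> C" "{d, e} \<in> C" "distinct [a, b, c, d, e]"
  shows "has_path5 C"
  using assms unfolding has_path5_def by blast

text \<open>Two triangles on a common edge have a Hamiltonian path starting at each of their four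
  vertices, so an edge leaving them would complete a five-vertex path.\<close>

lemma diamond_closed:
  assumes free: "\<not> has_path5 C" and C: "C \<subseteq> pairs {..<n}" and d: "distinct [p, q, r, s]"
    and E: "{p, q} \<in> C" "{p, r} \<in> C" "{q, r} \<in> C" "{p, s} \<in> C" "{q, s} \<in> C"
  shows "closed_under C {p, q, r, s}"
  unfolding closed_under_def
proof (intro ballI impI)
  fix e assume e: "e \<in> C" "e \<inter> {p, q, r, s} \<noteq> {}"
  show "e \<subseteq> {p, q, r, s}"
  proof (rule ccontr)
    assume ns: "\<not> e \<subseteq> {p, q, r, s}"
    have "e \<in> pairs {..<n}" using e C by auto
    then obtain x y where xy: "e = {x, y}" "x \<noteq> y" by (rule pairsE)
    obtain u w where uw: "{w, u} \<in> C" "u \<in> {p, q, r, s}" "w \<notin> {p, q, r, s}"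
      using e ns xy by (auto simp: insert_commute)
    have sym: "{q, p} \<in> C" "{r, p} \<in> C" "{r, q} \<in> C" "{s, p} \<in> C" "{s, q} \<in> C"
      using E by (simp_all add: insert_commute)
    from uw(2) consider "u = p" | "u = q" | "u = r" | "u = s" by auto
    then show False
    proof cases
      case 1 with uw sym E d free show False using has_path5I[of w p C r q s] by auto
    next
      case 2 with uw sym E d free show False using has_path5I[of w q C r p s] by auto
    next
      case 3 with uw sym E d free show False using has_path5I[of w r C p s q] by auto
    next
      case 4 with uw sym E d free show False using has_path5I[of w s C p r q] by auto
    qed
  qed
qed

text \<open>Triangles meeting in a single vertex contain a path through all five vertices. Triangles
  with a common edge span a closed four-set, to which the invariant applies.\<close>

lemma guarded_triangles_disjoint:
  assumes g: "guarded n C B 1" and free: "\<not> has_path5 C" and C: "C \<subseteq> pairs {..<n}"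
    and disj: "C \<inter> B = {}" and T: "T1 \<in> triangles n C" "T2 \<in> triangles n C" "T1 \<noteq> T2"
  shows "T1 \<inter> T2 = {}"
proof (rule ccontr)
  assume "T1 \<inter> T2 \<noteq> {}"
  then obtain p where p: "p \<in> T1" "p \<in> T2" by auto
  obtain a b where ab: "T1 = {p, a, b}" "distinct [p, a, b]" "{p, a} \<in> C" "{p, b} \<in> C" "{a, b} \<in> C"
    using triangleE[OF T(1) p(1)] by metis
  obtain c d where cd: "T2 = {p, c, d}" "distinct [p, c, d]" "{p, c} \<in> C" "{p, d} \<in> C" "{c, d} \<in> C"
    using triangleE[OF T(2) p(2)] by metis
  have diamond: False if "distinct [p, q, r, s]"
    "{p, q} \<in> C" "{p, r} \<in> C" "{q, r} \<in> C" "{p, s} \<in> C" "{q, s} \<in> C" for q r s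
  proof -
    let ?W = "{p, q, r, s}"
    have W: "closed_under C ?W" using free C that by (rule diamond_closed)
    have sub: "{{p, q}, {p, r}, {q, r}, {p, s}, {q, s}} \<subseteq> C \<inter> pairs ?W"
      using that by auto
    have "card {{p, q}, {p, r}, {q, r}, {p, s}, {q, s}} = 5"
      using that(1) by (auto simp: card_insert_if doubleton_eq_iff)
    then have "5 \<le> card (C \<inter> pairs ?W)"
      using card_mono[OF _ sub] by (simp add: finite_pairs)
    moreover have "?W \<subseteq> {..<n}"
      using subsetD[OF C that(2)] subsetD[OF C that(3)] subsetD[OF C that(5)] by auto
    moreover have c4: "card ?W = 4" using that(1) by simp
    \<comment> \<open>Five Constructor edges on four vertices demand two Blocker edges, but there
      are only six pairs.\<close>
    ultimately have "2 \<le> card (B \<inter> pairs ?W)"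
      using guardedD[OF g _ _ W] by simp
    moreover have "(4::nat) choose 2 = 6" by (simp add: numeral_eq_Suc)
    ultimately show False
      using card_disjoint_pairs_le[OF disj, of ?W] c4 \<open>5 \<le> card (C \<inter> pairs ?W)\<close> by simp
  qed
  show False
  proof (cases "{a, b} \<inter> {c, d} = {}")
    case True
    then show False
      using has_path5I[of a b C p c d] ab cd free by (auto simp: insert_commute)
  next
    case False
    then obtain q where q: "q \<in> {a, b}" "q \<in> {c, d}" by auto
    define r where "r = (if q = a then b else a)"
    define s where "s = (if q = c then d else c)"
    have r: "T1 = {p, q, r}" "distinct [p, q, r]" "{p, q} \<in> C" "{p, r} \<in> C" "{q, r} \<in> C"
      using ab q(1) by (auto simp: r_def insert_commute)
    have s: "T2 = {p, q, s}" "distinct [p, q, s]" "{p, s} \<in> C" "{q, s} \<in> C"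
      using cd q(2) by (auto simp: s_def insert_commute)
    have "r \<noteq> s" using r(1) s(1) T(3) by auto
    then show False using diamond[of q r s] r s by auto
  qed
qed

text \<open>The invariant gives every triangle an edge \<open>{u T, w T}\<close> leaving it; a
  shared vertex of two four-sets \<open>Q T\<close> would yield a five-vertex path or two meeting
  triangles.\<close>

lemma guarded_card_triangles:
  assumes g: "guarded n C B 1" and free: "\<not> has_path5 C" and C: "C \<subseteq> pairs {..<n}"
    and disj: "C \<inter> B = {}"
  shows "4 * card (triangles n C) \<le> n"
proof -
  have "\<exists>u w. u \<in> T \<and> w \<notin> T \<and> w < n \<and> {u, w} \<in> C" if T: "T \<in> triangles n C" for T
  proof -
    have T': "T \<subseteq> {..<n}" "card T = 3" "pairs T \<subseteq> C" using T by (auto simp: triangles_def)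
    have fin: "finite T" using T'(1) by (rule finite_subset) simp
    \<comment> \<open>A closed triangle has three Constructor edges and no Blocker edge, against 3 +
      1 \<le> 0 + 3.\<close>
    have "\<not> closed_under C T"
    proof
      assume "closed_under C T"
      then have "card (C \<inter> pairs T) + 1 \<le> card (B \<inter> pairs T) + card T"
        using guardedD[OF g T'(1)] T'(2) by blast
      moreover have "C \<inter> pairs T = pairs T" using T' by auto
      moreover have "B \<inter> pairs T = {}" using T' disj by auto
      moreover have "(3::nat) choose 2 = 3" by (simp add: numeral_eq_Suc)
      ultimately show False using T' fin by (simp add: card_pairs)
    qed
    then obtain e where e: "e \<in> C" "e \<inter> T \<noteq> {}" "\<not> e \<subseteq> T" by (auto simp: closed_under_def)
    then have "e \<in> pairs {..<n}" using C by auto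
    then obtain x y where xy: "e = {x, y}" "x < n" "y < n" by (auto elim: pairsE)
    then have "{x, y} \<in> C" "{y, x} \<in> C" using e by (simp_all add: insert_commute)
    then show ?thesis using e xy by auto
  qed
  then obtain u w where uw: "\<And>T. T \<in> triangles n C \<Longrightarrow>
      u T \<in> T \<and> w T \<notin> T \<and> w T < n \<and> {u T, w T} \<in> C"
    by metis
  define Q where "Q T = insert (w T) T" for T
  have sub: "T \<subseteq> {..<n}" "card T = 3" "finite T" if "T \<in> triangles n C" for T
    using that by (auto simp: triangles_def intro: finite_subset)
  \<comment> \<open>Otherwise a path with two vertices in \<open>T1\<close> crosses over to
    \<open>w T1\<close> and traverses all of \<open>T2\<close>.\<close>
  have no: "w T1 \<notin> T2" if T: "T1 \<in> triangles n C" "T2 \<in> triangles n C" "T1 \<noteq> T2" for T1 T2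
  proof
    assume w: "w T1 \<in> T2"
    have D: "T1 \<inter> T2 = {}" using guarded_triangles_disjoint g free C disj T by blast
    obtain x where x: "x \<in> T1" "x \<noteq> u T1" "{x, u T1} \<in> C"
      using triangle_pathE[OF T(1)] uw[OF T(1)] by (metis distinct_length_2_or_more)
    obtain x' y' where x': "x' \<in> T2" "y' \<in> T2" "distinct [w T1, x', y']"
      "{w T1, x'} \<in> C" "{x', y'} \<in> C"
      using triangle_pathE[OF T(2) w] by metis
    have "distinct [x, u T1, w T1, x', y']"
      using x x' w uw[OF T(1)] D by auto
    then show False
      using has_path5I[of x "u T1" C "w T1" x' y'] uw[OF T(1)] x x' free by blast
  qed
  have disjQ: "Q T1 \<inter> Q T2 = {}"
    if T: "T1 \<in> triangles n C" "T2 \<in> triangles n C" "T1 \<noteq> T2" for T1 T2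
  proof -
    have D: "T1 \<inter> T2 = {}" using guarded_triangles_disjoint g free C disj T by blast
    \<comment> \<open>A common outside neighbour would be the midpoint of a path with two vertices
      in each triangle.\<close>
    have "w T1 \<noteq> w T2"
    proof
      assume w: "w T1 = w T2"
      obtain x where x: "x \<in> T1" "x \<noteq> u T1" "{x, u T1} \<in> C"
        using triangle_pathE[OF T(1)] uw[OF T(1)] by (metis distinct_length_2_or_more)
      obtain x' where x': "x' \<in> T2" "x' \<noteq> u T2" "{u T2, x'} \<in> C"
        using triangle_pathE[OF T(2)] uw[OF T(2)] by (metis distinct_length_2_or_more)
      have "{w T1, u T2} \<in> C" using uw[OF T(2)] w by (simp add: insert_commute)
      moreover have "distinct [x, u T1, w T1, u T2, x']"
        using x x' w uw[OF T(1)] uw[OF T(2)] D by auto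
      ultimately show False
        using has_path5I[of x "u T1" C "w T1" "u T2" x'] uw[OF T(1)] x x' free by blast
    qed
    then show ?thesis
      using D no[OF T] no[of T2 T1] T by (auto simp: Q_def)
  qed
  have fin: "finite (triangles n C)"
    by (rule finite_subset[of _ "Pow {..<n}"]) (auto simp: triangles_def)
  have "4 * card (triangles n C) = (\<Sum>T\<in>triangles n C. card (Q T))"
    using sub uw by (simp add: Q_def)
  also have "\<dots> = card (\<Union>T\<in>triangles n C. Q T)"
    using fin sub disjQ by (subst card_UN_disjoint) (auto simp: Q_def)
  also have "\<dots> \<le> card {..<n}"
    using sub uw by (intro card_mono) (auto simp: Q_def)
  finally show ?thesis by simp
qed

text \<open>Induction over pairs of moves by the number of unclaimed edges. The game may end after
  either player's move, so the score is bounded through \<open>s = 1\<close>, which holds at both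
  kinds of position.\<close>

lemma game_value_guarded_le:
  assumes "guarded n C B 2" "\<not> has_path5 C" "C \<subseteq> pairs {..<n}" "C \<inter> B = {}"
  shows "game_value n (complete_graph 3) (path_graph 5) Constructor C B \<le> n div 4"
  using assms
proof (induction "card (unclaimed n C B)" arbitrary: C B rule: less_induct)
  case less
  have score: "score n (complete_graph 3) C' \<le> n div 4"
    if "guarded n C' B 1" "\<not> has_path5 C'" "C' \<subseteq> pairs {..<n}" "C' \<inter> B = {}" for C'
    using guarded_card_triangles[OF that] by (simp add: score_triangle)
  have "guarded n C B 1"
    unfolding guarded_def
  proof (intro allI impI)
    fix W assume "W \<subseteq> {..<n} \<and> (card W = 3 \<or> card W = 4) \<and> closed_under C W"
    then have "card (C \<inter> pairs W) + 2 \<le> card (B \<inter> pairs W) + card W"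
      using guardedD[OF less.prems(1)] by blast
    then show "card (C \<inter> pairs W) + 1 \<le> card (B \<inter> pairs W) + card W" by linarith
  qed
  then have "score n (complete_graph 3) C \<le> n div 4"
    using less.prems by (intro score)
  then show ?case
  proof (rule game_value_constructor_le)
    fix e assume "e \<in> constructor_moves n (path_graph 5) C B"
    then have e: "e \<in> pairs {..<n} - (C \<union> B)" "\<not> has_path5 (insert e C)"
      using less.prems by (auto simp: constructor_moves_path5)
    have inv: "insert e C \<subseteq> pairs {..<n}" "insert e C \<inter> B = {}"
      using e less.prems by auto
    have "guarded n (insert e C) B 1"
      using less.prems(1) by (rule guarded_insert_constructor)
    then have "score n (complete_graph 3) (insert e C) \<le> n div 4"
      using e inv by (intro score)
    then show "game_value n (complete_graph 3) (path_graph 5) Blocker (insert e C) B \<le> n div 4"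
    proof (rule game_value_blocker_le)
      assume "unclaimed n (insert e C) B \<noteq> {}"
      then obtain f where f: "f \<in> unclaimed n (insert e C) B"
        "guarded n (insert e C) (insert f B) 2"
        using guarded_insert_blocker less.prems e by metis
      have "card (unclaimed n (insert e C) (insert f B)) < card (unclaimed n (insert e C) B)"
        using f(1) by (rule card_unclaimed_less)
      also have "\<dots> < card (unclaimed n C B)"
        using e by (intro card_unclaimed_less) (simp add: unclaimed_pairs)
      finally have "game_value n (complete_graph 3) (path_graph 5) Constructor
          (insert e C) (insert f B) \<le> n div 4"
        using f e inv by (intro less.hyps) (auto simp: unclaimed_pairs)
      then show "\<exists>f\<in>unclaimed n (insert e C) B. game_value n (complete_graph 3) (path_graph 5)
          Constructor (insert e C) (insert f B) \<le> n div 4"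
        using f by blast
    qed
  qed
qed

text \<open>On the empty board both counts are zero and \<open>card W\<close> is at least 3, so the
  invariant holds at the start.\<close>

lemma constructor_blocker_upper:
  "constructor_blocker n (complete_graph 3) (path_graph 5) \<le> n div 4"
  unfolding constructor_blocker_def
  by (rule game_value_guarded_le) (auto simp: guarded_def has_path5_def)

section \<open>Constructor's strategy\<close>

text \<open>Each step of the induction on \<open>t\<close> removes a largest independent set. It has
  fewer than \<open>k\<close> vertices and every remaining vertex sends an edge of \<open>B\<close>
  to it; the term \<open>k * t * t\<close> pays for the removed vertices.\<close>

lemma independent_set_bound:
  assumes "finite R" and "\<And>I. I \<subseteq> R \<Longrightarrow> B \<inter> pairs I = {} \<Longrightarrow> card I < k"
  shows "t * card R \<le> card (B \<inter> pairs R) + k * t * t"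
  using assms
proof (induction t arbitrary: R)
  case 0
  then show ?case by simp
next
  case (Suc t)
  have "\<forall>J. J \<subseteq> R \<and> B \<inter> pairs J = {} \<longrightarrow> card J < Suc (card R)"
    using Suc.prems(1) by (simp add: card_mono less_Suc_eq_le)
  moreover have "{} \<subseteq> R \<and> B \<inter> pairs {} = {}" by (auto simp: pairs_def)
  ultimately obtain I where ind: "I \<subseteq> R \<and> B \<inter> pairs I = {}" and
    max: "\<And>J. J \<subseteq> R \<Longrightarrow> B \<inter> pairs J = {} \<Longrightarrow> card J \<le> card I"
    using ex_has_greatest_nat[of "\<lambda>I. I \<subseteq> R \<and> B \<inter> pairs I = {}" "{}" card] by metis
  define R' where "R' = R - I"
  have finI: "finite I" and finR': "finite R'"
    using ind Suc.prems(1) by (auto simp: R'_def intro: finite_subset)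
  \<comment> \<open>Otherwise \<open>x\<close> could be added to \<open>I\<close>, contradicting its
    maximal size.\<close>
  have "\<exists>y\<in>I. {x, y} \<in> B" if x: "x \<in> R'" for x
  proof (rule ccontr)
    assume "\<not> ?thesis"
    then have "B \<inter> pairs (insert x I) = {}"
      using ind by (auto elim!: pairsE simp: insert_commute disjoint_iff)
    moreover have "card (insert x I) = Suc (card I)"
      using x finI by (simp add: R'_def)
    ultimately show False using max[of "insert x I"] x ind by (auto simp: R'_def)
  qed
  then obtain y where y: "\<And>x. x \<in> R' \<Longrightarrow> y x \<in> I \<and> {x, y x} \<in> B" by metis
  have yR: "y x \<in> R" "x \<noteq> y x" if "x \<in> R'" for x
    using y[OF that] ind that by (auto simp: R'_def)
  \<comment> \<open>Exactly one end of such an edge lies in \<open>R'\<close>, so different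
    \<open>x\<close> give different edges, none of them inside \<open>R'\<close>.\<close>
  have inj: "inj_on (\<lambda>x. {x, y x}) R'"
    using y by (auto simp: inj_on_def doubleton_eq_iff R'_def)
  have "card (B \<inter> pairs R') + card R' = card ((B \<inter> pairs R') \<union> (\<lambda>x. {x, y x}) ` R')"
    using inj finR' y
    by (subst card_Un_disjoint) (auto simp: card_image finite_pairs R'_def)
  also have "\<dots> \<le> card (B \<inter> pairs R)"
    using Suc.prems(1) y yR pairs_mono[of R' R]
    by (intro card_mono) (auto simp: finite_pairs R'_def)
  finally have edges: "card (B \<inter> pairs R') + card R' \<le> card (B \<inter> pairs R)" .
  have IH: "t * card R' \<le> card (B \<inter> pairs R') + k * t * t"
    using finR' by (rule Suc.IH) (use Suc.prems(2) in \<open>auto simp: R'_def\<close>)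
  have "card R = card R' + card I"
    using ind finI Suc.prems(1) card_mono[of R I] by (simp add: R'_def card_Diff_subset)
  moreover have "card I < k" using Suc.prems(2) ind by blast
  ultimately have "card R \<le> card R' + k" by linarith
  then have "Suc t * card R \<le> Suc t * (card R' + k)" by (rule mult_le_mono2)
  also have "\<dots> = t * card R' + card R' + k * Suc t" by (simp add: algebra_simps)
  also have "\<dots> \<le> card (B \<inter> pairs R) + (k * t * t + k * Suc t)" using IH edges by linarith
  also have "k * t * t + k * Suc t \<le> k * Suc t * Suc t" by (simp add: algebra_simps)
  finally show ?case by simp
qed

section \<open>Keeping Constructor's components small\<close>

text \<open>A condition that makes moves legal and survives play on fresh vertices: components
  containing an edge have at most four vertices, expressed through closed supersets.\<close>

definition small_components :: "nat set set \<Rightarrow> bool" where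
  "small_components C \<longleftrightarrow> (\<forall>e\<in>C. \<exists>W. e \<subseteq> W \<and> closed_under C W \<and> finite W \<and> card W \<le> 4)"

text \<open>A path cannot leave the closed set around its first edge, which has no room for five
  vertices.\<close>

lemma small_components_no_path5:
  assumes "small_components C"
  shows "\<not> has_path5 C"
proof
  assume "has_path5 C"
  then obtain a b c d e where D: "distinct [a, b, c, d, e]"
    and E: "{a, b} \<in> C" "{b, c} \<in> C" "{c, d} \<in> C" "{d, e} \<in> C"
    unfolding has_path5_def by blast
  obtain W where W: "{a, b} \<subseteq> W" "closed_under C W" "finite W" "card W \<le> 4"
    using assms E(1) unfolding small_components_def by blast
  have step: "y \<in> W" if "{x, y} \<in> C" "x \<in> W" for x y
  proof -
    have "{x, y} \<subseteq> W"
      using W(2) that by (rule closed_underD[where x = x]) simp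
    then show ?thesis by simp
  qed
  have "{a, b, c, d, e} \<subseteq> W"
    using W(1) step[OF E(2)] step[OF E(3)] step[OF E(4)] by simp
  then have "card {a, b, c, d, e} \<le> 4"
    using card_mono[OF W(3), of "{a, b, c, d, e}"] W(4) by linarith
  then show False using D by simp
qed

lemma small_components_Un:
  assumes C: "small_components C" and W: "finite W" "card W \<le> 4" "W \<inter> \<Union>C = {}"
    and E: "E \<subseteq> pairs W"
  shows "small_components (C \<union> E)"
  unfolding small_components_def
proof
  fix e assume "e \<in> C \<union> E"
  have E': "\<And>x. x \<in> E \<Longrightarrow> x \<subseteq> W" using E by (auto simp: pairs_def)
  show "\<exists>X. e \<subseteq> X \<and> closed_under (C \<union> E) X \<and> finite X \<and> card X \<le> 4"
  proof (cases "e \<in> C")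
    case True
    then obtain X where X: "e \<subseteq> X" "closed_under C X" "finite X" "card X \<le> 4"
      using C unfolding small_components_def by blast
    \<comment> \<open>The old witness \<open>X\<close> may contain vertices of \<open>W\<close>; no
      edge of \<open>C\<close> meets these, so dropping them keeps it closed and separates it from
      the new edges.\<close>
    have "closed_under (C \<union> E) (X - W)"
      unfolding closed_under_def
    proof (intro ballI impI)
      fix d assume d: "d \<in> C \<union> E" "d \<inter> (X - W) \<noteq> {}"
      then have "d \<in> C" using E' by auto
      moreover from this have "d \<subseteq> X" using X(2) d(2) by (auto simp: closed_under_def)
      ultimately show "d \<subseteq> X - W" using W(3) by auto
    qed
    moreover have "card (X - W) \<le> 4"
      using X by (meson Diff_subset card_mono le_trans)
    ultimately show ?thesis
      using X True W(3) by (intro exI[of _ "X - W"]) auto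
  next
    case False
    then have "e \<in> E" using \<open>e \<in> C \<union> E\<close> by blast
    moreover have "closed_under (C \<union> E) W"
      using W(3) E' by (fastforce simp: closed_under_def)
    ultimately show ?thesis using W E' by blast
  qed
qed

text \<open>Here \<open>E\<close> holds the edges of the current round. Play confined to at most
  four fresh vertices creates no five-vertex path, so any unclaimed pair in \<open>W\<close> is a
  legal move.\<close>

lemma constructor_claim:
  assumes C: "small_components C" "C \<subseteq> pairs {..<n}"
    and W: "finite W" "card W \<le> 4" "W \<subseteq> {..<n}" "W \<inter> \<Union>C = {}"
    and E: "insert e E \<subseteq> pairs W" "e \<notin> E" "e \<notin> B"
    and le: "k \<le> game_value n H (path_graph 5) Blocker (C \<union> insert e E) B"
  shows "k \<le> game_value n H (path_graph 5) Constructor (C \<union> E) B"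
proof -
  have sc: "small_components (C \<union> insert e E)"
    using C(1) W(1,2,4) E(1) by (rule small_components_Un)
  have "e \<notin> C" using E(1) W(4) by (auto elim!: pairsE)
  then have "e \<in> constructor_moves n (path_graph 5) (C \<union> E) B"
    using small_components_no_path5[OF sc] E pairs_mono[OF W(3)] C(2)
    by (subst constructor_moves_path5) auto
  from game_value_constructor_ge[OF this, of H] le show ?thesis by simp
qed

text \<open>A triangle is forced in three or four moves. The hypothesis \<open>win\<close> acts as a
  continuation: it bounds the value once the triangle exists, for every \<open>B'\<close> with at
  most four more edges.\<close>

lemma constructor_round:
  assumes C: "small_components C" "C \<subseteq> pairs {..<n}"
    and I: "I \<subseteq> {..<n}" "I \<inter> \<Union>C = {}" "card I = 6" "B \<inter> pairs I = {}" and B: "finite B"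
    and win: "\<And>W E T B'. W \<subseteq> I \<Longrightarrow> card W \<le> 4 \<Longrightarrow> E \<subseteq> pairs W \<Longrightarrow> T \<subseteq> W \<Longrightarrow> card T = 3 \<Longrightarrow>
      pairs T \<subseteq> E \<Longrightarrow> finite B' \<Longrightarrow> card B' \<le> card B + 4 \<Longrightarrow>
      k \<le> game_value n H (path_graph 5) Constructor (C \<union> E) B'"
  shows "k \<le> game_value n H (path_graph 5) Constructor C B"
proof -
  let ?val = "game_value n H (path_graph 5)"
  have finI: "finite I" using I(3) by (simp add: card_ge_0_finite)
  have noB: "{x, y} \<notin> B" if "x \<in> I" "y \<in> I" "x \<noteq> y" for x y
    using I(4) that by auto
  have claim: "k \<le> ?val Constructor (C \<union> E) B'"
    if "W \<subseteq> I" "card W \<le> 4" "insert e E \<subseteq> pairs W" "e \<notin> E" "e \<notin> B'"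
      "k \<le> ?val Blocker (C \<union> insert e E) B'" for W e E B'
    using C _ that(2) _ _ that(3-)
    by (rule constructor_claim) (use that(1) I finI in \<open>auto intro: finite_subset\<close>)
  have card_B: "finite B' \<and> card B' \<le> card B + j + 1"
    if "finite D \<and> card D \<le> card B + j" "B' \<subseteq> insert f D" for B' D f j
  proof -
    have "finite (insert f D)" "card (insert f D) \<le> card B + j + 1"
      using that by (auto simp: card_insert_if)
    then show ?thesis
      using card_mono[of "insert f D" B'] finite_subset[of B' "insert f D"] that by simp
  qed
  have pairs3: "pairs {x, y, z} \<subseteq> {{x, y}, {x, z}, {y, z}}" for x y z :: nat
    by (auto elim!: pairsE)
  \<comment> \<open>No choice excludes more than five vertices: at worst \<open>v\<close>,
    \<open>a\<close>, \<open>b\<close> and the two ends of the first reply. This is why six are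
    provided.\<close>
  have pick: "\<exists>x\<in>I. x \<notin> X" if "finite X" "card X < 6" for X
    using that I(3) by (metis card_mono linorder_not_less subsetI)
  obtain v where v: "v \<in> I" using pick[of "{}"] by auto
  obtain a where a: "a \<in> I" "a \<noteq> v" using pick[of "{v}"] by auto
  have "k \<le> ?val Constructor (C \<union> {}) B"
  proof (rule claim[of "{v, a}" "{v, a}"])
    show "k \<le> ?val Blocker (C \<union> {{v, a}}) B"
    proof (rule game_value_blocker_ge)
      fix f1 B1 assume f1: "finite f1" "card f1 \<le> 2" and B1: "B \<subseteq> B1" "B1 \<subseteq> insert f1 B"
      have cB1: "finite B1 \<and> card B1 \<le> card B + 1" using card_B[of B 0 B1 f1] B B1 by simp
      \<comment> \<open>Choosing \<open>b\<close> off the first reply keeps every pair of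
        \<open>I\<close> at \<open>b\<close> free of Blocker.\<close>
      have "card ({v, a} \<union> f1) \<le> 4"
        using f1 card_Un_le[of "{v, a}" f1] a by simp
      then obtain b where b: "b \<in> I" "b \<noteq> v" "b \<noteq> a" "b \<notin> f1"
        using pick[of "{v, a} \<union> f1"] f1 by auto
      have B1b: "{x, b} \<notin> B1" "{b, x} \<notin> B1" if "x \<in> I" "x \<noteq> b" for x
        using B1 b noB that by blast+
      show "k \<le> ?val Constructor (C \<union> {{v, a}}) B1"
      proof (rule claim[of "{v, a, b}" "{v, b}"])
        show "k \<le> ?val Blocker (C \<union> {{v, b}, {v, a}}) B1"
        proof (rule game_value_blocker_ge)
          fix f2 B2 assume f2: "finite f2" "card f2 \<le> 2" and B2: "B1 \<subseteq> B2" "B2 \<subseteq> insert f2 B1"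
          have cB2: "finite B2 \<and> card B2 \<le> card B + 2" using card_B[of B1 1 B2 f2] cB1 B2 by simp
          show "k \<le> ?val Constructor (C \<union> {{v, b}, {v, a}}) B2"
          proof (cases "{a, b} \<in> B2")
            case False
            show ?thesis
            proof (rule claim[of "{v, a, b}" "{a, b}"])
              show "k \<le> ?val Blocker (C \<union> {{a, b}, {v, b}, {v, a}}) B2"
              proof (rule game_value_blocker_ge)
                fix f3 B3 assume B3: "B2 \<subseteq> B3" "B3 \<subseteq> insert f3 B2"
                have cB3: "finite B3 \<and> card B3 \<le> card B + 3"
                  using card_B[of B2 2 B3 f3] cB2 B3 by simp
                show "k \<le> ?val Constructor (C \<union> {{a, b}, {v, b}, {v, a}}) B3"
                  by (rule win[of "{v, a, b}" _ "{v, a, b}"])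
                    (use v a b cB3 pairs3[of v a b] in auto)
              qed
            qed (use v a b False in \<open>auto simp: doubleton_eq_iff card_insert_if\<close>)
          next
            case True
            \<comment> \<open>The pair \<open>{a, b}\<close> was free before, so the second reply
              was spent on it; a further vertex \<open>c\<close> off the first reply still meets no
              Blocker edge inside \<open>I\<close>.\<close>
            then have f2_eq: "f2 = {a, b}" using B2 B1b[of a] a b by auto
            have "card ({v, a, b} \<union> f1) \<le> 5"
              using f1 card_Un_le[of "{v, a, b}" f1] a b by simp
            then obtain c where c: "c \<in> I" "c \<noteq> v" "c \<noteq> a" "c \<noteq> b" "c \<notin> f1"
              using pick[of "{v, a, b} \<union> f1"] f1 by auto
            have B2c: "{x, c} \<notin> B2" if "x \<in> I" "x \<noteq> c" for x
              using B2 B1 c noB that unfolding f2_eq by blast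
            show ?thesis
            proof (rule claim[of "{v, a, b, c}" "{v, c}"])
              show "k \<le> ?val Blocker (C \<union> {{v, c}, {v, b}, {v, a}}) B2"
              proof (rule game_value_blocker_ge)
                fix f3 B3 assume B3: "B2 \<subseteq> B3" "B3 \<subseteq> insert f3 B2"
                have cB3: "finite B3 \<and> card B3 \<le> card B + 3"
                  using card_B[of B2 2 B3 f3] cB2 B3 by simp
                \<comment> \<open>One reply cannot claim both pairs; the free one closes a triangle
                  with \<open>v\<close>.\<close>
                have "{a, c} \<noteq> {b, c}" using b c by (auto simp: doubleton_eq_iff)
                then obtain x where x: "x = a \<or> x = b" "{x, c} \<notin> B3"
                  using B3 B2c[of a] B2c[of b] a b c by blast
                show "k \<le> ?val Constructor (C \<union> {{v, c}, {v, b}, {v, a}}) B3"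
                proof (rule claim[of "{v, a, b, c}" "{x, c}"])
                  show "k \<le> ?val Blocker (C \<union> {{x, c}, {v, c}, {v, b}, {v, a}}) B3"
                  proof (rule game_value_blocker_ge)
                    fix f4 B4 assume B4: "B3 \<subseteq> B4" "B4 \<subseteq> insert f4 B3"
                    have cB4: "finite B4 \<and> card B4 \<le> card B + 4"
                      using card_B[of B3 3 B4 f4] cB3 B4 by simp
                    show "k \<le> ?val Constructor (C \<union> {{x, c}, {v, c}, {v, b}, {v, a}}) B4"
                      by (rule win[of "{v, a, b, c}" _ "{v, x, c}"])
                        (use v a b c x cB4 pairs3[of v x c] in auto)
                  qed
                qed (use v a b c x in \<open>auto simp: doubleton_eq_iff\<close>)
              qed
            qed (use v a b c B2c in \<open>auto simp: doubleton_eq_iff\<close>)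
          qed
        qed
      qed (use v a b B1b in \<open>auto simp: doubleton_eq_iff card_insert_if\<close>)
    qed
  qed (use v a noB in \<open>auto simp: card_insert_if\<close>)
  then show ?thesis by simp
qed

text \<open>A round costs at most four Blocker edges and four untouched vertices; the terms
  \<open>4 * k\<close> reserve these for the \<open>k\<close> remaining rounds, each of which adds a
  triangle.\<close>

lemma game_value_rounds:
  assumes "small_components C" "C \<subseteq> pairs {..<n}" "finite B" "card B + 4 * k \<le> n"
    and "7 * t + 4 * k \<le> card ({..<n} - \<Union>C)" "n < t * t"
  shows "score n (complete_graph 3) C + k
    \<le> game_value n (complete_graph 3) (path_graph 5) Constructor C B"
  using assms
proof (induction k arbitrary: C B)
  case 0
  then show ?case by (simp add: score_le_game_value)
next
  case (Suc k)
  let ?R = "{..<n} - \<Union>C"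
  \<comment> \<open>If all independent sets had fewer than six vertices, the bound would give 7 t^2
    \<le> n + 6 t^2, contradicting n < t^2.\<close>
  have "\<exists>I. I \<subseteq> ?R \<and> B \<inter> pairs I = {} \<and> 6 \<le> card I"
  proof (rule ccontr)
    assume "\<not> ?thesis"
    then have "t * card ?R \<le> card (B \<inter> pairs ?R) + 6 * t * t"
      by (intro independent_set_bound) (auto simp: not_le)
    moreover have "card (B \<inter> pairs ?R) \<le> card B"
      using Suc.prems by (intro card_mono) auto
    moreover have "t * (7 * t) \<le> t * card ?R"
      using Suc.prems by (intro mult_le_mono2) linarith
    ultimately show False using Suc.prems by simp
  qed
  then obtain J where J: "J \<subseteq> ?R" "B \<inter> pairs J = {}" "6 \<le> card J" by blast
  obtain I where I: "I \<subseteq> J" "card I = 6"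
    using J(3) by (rule obtain_subset_with_card_n)
  show ?case
  proof (rule constructor_round[of C n I B])
    show "B \<inter> pairs I = {}" using J I pairs_mono[of I J] by auto
  next
    fix W E T and B' :: "nat set set"
    assume W: "W \<subseteq> I" "card W \<le> 4" "E \<subseteq> pairs W" and T: "T \<subseteq> W" "card T = 3" "pairs T \<subseteq> E"
      and B': "finite B'" "card B' \<le> card B + 4"
    have "finite I" using I(2) by (simp add: card_ge_0_finite)
    then have WR: "W \<subseteq> ?R" "finite W" using W I J by (auto intro: finite_subset)
    have sub: "\<Union>E \<subseteq> W" using W by (auto simp: pairs_def)
    \<comment> \<open>The vertices of \<open>T\<close> were untouched before the round, so this
      triangle is new.\<close>
    have "T \<notin> triangles n C"
    proof
      assume "T \<in> triangles n C"
      moreover have "T \<noteq> {}" using T by auto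
      ultimately obtain u x where "u \<in> T" "{u, x} \<in> C"
        by (metis ex_in_conv triangleE)
      then show False using WR T by auto
    qed
    moreover have "T \<in> triangles n (C \<union> E)"
      using T WR by (auto simp: triangles_def)
    moreover have "triangles n C \<subseteq> triangles n (C \<union> E)"
      by (auto simp: triangles_def)
    moreover have "finite (triangles n (C \<union> E))"
      by (rule finite_subset[of _ "Pow {..<n}"]) (auto simp: triangles_def)
    ultimately have "card (triangles n C) < card (triangles n (C \<union> E))"
      by (intro psubset_card_mono) auto
    then have "score n (complete_graph 3) C + Suc k \<le> score n (complete_graph 3) (C \<union> E) + k"
      by (simp add: score_triangle)
    also have "\<dots> \<le> game_value n (complete_graph 3) (path_graph 5) Constructor (C \<union> E) B'"
    proof (rule Suc.IH)
      show "small_components (C \<union> E)"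
        using Suc.prems(1) WR W by (intro small_components_Un) auto
      show "C \<union> E \<subseteq> pairs {..<n}"
        using Suc.prems(2) W WR pairs_mono[of W "{..<n}"] by auto
      \<comment> \<open>The round touches only vertices of \<open>W\<close>, hence at most
        four.\<close>
      have "card (?R - W) \<le> card ({..<n} - \<Union>(C \<union> E))"
        using sub by (intro card_mono) auto
      moreover have "card (?R - W) = card ?R - card W"
        using WR by (intro card_Diff_subset) auto
      ultimately show "7 * t + 4 * k \<le> card ({..<n} - \<Union>(C \<union> E))"
        using Suc.prems(5) W(2) by simp
    qed (use Suc.prems B' in auto)
    finally show "score n (complete_graph 3) C + Suc k
      \<le> game_value n (complete_graph 3) (path_graph 5) Constructor (C \<union> E) B'" .
  qed (use Suc.prems I J in auto)
qed

section \<open>The asymptotic estimate\<close>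

lemma constructor_blocker_lower:
  assumes "n < t * t" "7 * t + 4 * k \<le> n"
  shows "k \<le> constructor_blocker n (complete_graph 3) (path_graph 5)"
proof -
  have "score n (complete_graph 3) {} + k
    \<le> game_value n (complete_graph 3) (path_graph 5) Constructor {} {}"
    by (rule game_value_rounds[where t = t]) (use assms in \<open>auto simp: small_components_def\<close>)
  then show ?thesis by (simp add: constructor_blocker_def)
qed

theorem theorem1p5:
  "(\<lambda>n. real n / 4 - real (constructor_blocker n (complete_graph 3) (path_graph 5)))
     \<in> o(\<lambda>n. real n)"
proof -
  let ?g = "\<lambda>n. constructor_blocker n (complete_graph 3) (path_graph 5)"
  \<comment> \<open>The lower bound loses at most (7 t + 3) / 4 \<le> (7 sqrt n + 10) / 4, where the
    3 comes from rounding in \<open>div 4\<close>; the right-hand side rounds this up.\<close>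
  have bound: "\<bar>real n / 4 - real (?g n)\<bar> \<le> 2 * sqrt (real n) + 3" for n
  proof -
    \<comment> \<open>This is the least \<open>t\<close> with \<open>n < t * t\<close>.\<close>
    define t where "t = Suc (nat \<lfloor>sqrt (real n)\<rfloor>)"
    have t: "real t \<le> sqrt (real n) + 1" "sqrt (real n) < real t"
      unfolding t_def by (simp_all, linarith)
    have "0 < t" by (simp add: t_def)
    have "real n = sqrt (real n) * sqrt (real n)" by simp
    also have "\<dots> < real t * real t"
      using t(2) \<open>0 < t\<close> by (intro mult_strict_mono) auto
    finally have nt: "n < t * t" by (metis of_nat_less_iff of_nat_mult)
    have "(n - 7 * t) div 4 \<le> ?g n"
    \<comment> \<open>For smaller \<open>n\<close> truncated subtraction gives 0 and the bound is
      trivial.\<close>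
    proof (cases "7 * t \<le> n")
      case True
      then show ?thesis using nt by (intro constructor_blocker_lower[of n t]) auto
    qed simp
    then have "n \<le> 4 * ?g n + 7 * t + 3" by linarith
    then have "real n \<le> 4 * real (?g n) + 7 * real t + 3" by linarith
    moreover have "4 * ?g n \<le> n" using constructor_blocker_upper[of n] by linarith
    then have "4 * real (?g n) \<le> real n" by linarith
    ultimately show ?thesis using t by (simp add: abs_if)
  qed
  have "(\<lambda>n. real n / 4 - real (?g n)) \<in> O(\<lambda>n. 2 * sqrt (real n) + 3)"
    by (rule bigoI[of _ 1]) (use bound in \<open>auto intro!: always_eventually simp: abs_of_nonneg\<close>)
  also have "(\<lambda>n. 2 * sqrt (real n) + 3) \<in> o(\<lambda>n. real n)"
    by real_asymp
  finally show ?thesis .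
qed

end
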